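(* Let $\phi:\mathbb{R}^n\to\mathbb{R}$ be convex and twice continuously differentiable, attaining its minimum value $\phi^*$, with $\nabla\phi$ Lipschitz-continuous with constant $L>0$, and suppose there is $\mu>0$ such that $\mu(\phi(u)-\phi^* )\le\frac12\|\nabla\phi(u)\|^2$ for all $u\in\mathbb{R}^n$. Let $\alpha>0$, $z\notin\mathrm{argmin}(\phi)$, and let $x$ be the solution of $\ddot x(t)+\frac{\alpha}{t}\dot x(t)+\nabla\phi(x(t))=0$ with $x(0)=z$, $\dot x(0)=0$. Set $\tau_3=\sqrt{\frac{\alpha+3}{(\alpha+2)L}}$ and let $T(z)$ be the restarting time. Then for every $t\in[\tau_3,T(z)]$, $$\phi\big(x(t)\big)-\phi^*\le\left(1-\frac{4\alpha(\alpha+3)}{(\alpha+2)(2\alpha+3)^2}\,\frac{\mu}{L}\right)\big(\phi(z)-\phi^*\big).$$ In particular, for $\alpha=3$, for every $t\in[\tau_3,T(z)]$, $$\phi\big(x(t)\big)-\phi^*\le\left(1-\frac{8}{45}\,\frac{\mu}{L}\right)\big(\phi(z)-\phi^*\big).$$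
   Context: A solution is a function in $C^2((0,+\infty);\mathbb{R}^n)\cap C^1([0,+\infty);\mathbb{R}^n)$ satisfying the initial conditions and the equation for every $t>0$ (it exists and is unique). The restarting time is $T(z)=\inf\{t>0:\ \frac{d}{dt}\|\dot x(t)\|^2\le0\}$. *)

theory Defs
  imports "HOL-Analysis.Analysis" "HOL-Library.Extended_Real"
begin

definition gradient :: "('a::real_inner \<Rightarrow> real) \<Rightarrow> 'a \<Rightarrow> 'a" where
  "gradient f u = (THE D. GDERIV f u :> D)"

(* C^2 on the whole space, in terms of the first and second Frechet derivatives *)
definition twice_continuously_differentiable :: "('a::real_normed_vector \<Rightarrow> real) \<Rightarrow> bool" where
  "twice_continuously_differentiable f \<longleftrightarrow>
     (\<exists>(f' :: 'a \<Rightarrow> 'a \<Rightarrow>\<^sub>L real) (f'' :: 'a \<Rightarrow> 'a \<Rightarrow>\<^sub>L ('a \<Rightarrow>\<^sub>L real)).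
        (\<forall>u. (f has_derivative blinfun_apply (f' u)) (at u)) \<and>
        (\<forall>u. (f' has_derivative blinfun_apply (f'' u)) (at u)) \<and>
        continuous_on UNIV f'')"

definition argmin :: "('a \<Rightarrow> real) \<Rightarrow> 'a set" where
  "argmin f = {u. is_arg_min f (\<lambda>_. True) u}"

(* The derivative is one-sided at t = 0 and the usual two-sided one for t > 0;
   values of x at negative times play no role. *)
definition velocity :: "(real \<Rightarrow> 'a::real_normed_vector) \<Rightarrow> real \<Rightarrow> 'a" where
  "velocity x t = vector_derivative x (at t within {0..})"

definition acceleration :: "(real \<Rightarrow> 'a::real_normed_vector) \<Rightarrow> real \<Rightarrow> 'a" where
  "acceleration x t = vector_derivative (velocity x) (at t)"

definition is_solution ::
  "('a::real_inner \<Rightarrow> real) \<Rightarrow> real \<Rightarrow> 'a \<Rightarrow> (real \<Rightarrow> 'a) \<Rightarrow> bool" where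
  "is_solution \<phi> \<alpha> z x \<longleftrightarrow>
     x differentiable_on {0..} \<and> continuous_on {0..} (velocity x) \<and>
     velocity x differentiable_on {0<..} \<and> continuous_on {0<..} (acceleration x) \<and>
     x 0 = z \<and> velocity x 0 = 0 \<and>
     (\<forall>t>0. acceleration x t + (\<alpha> / t) *\<^sub>R velocity x t + gradient \<phi> (x t) = 0)"

(* The infimum is taken in the extended reals, so that it is \<infinity> for the empty set
   (the real-valued Inf of the empty set would be a junk value). *)
definition restarting_time :: "(real \<Rightarrow> 'a::real_normed_vector) \<Rightarrow> ereal" where
  "restarting_time x =
     Inf (ereal ` {t. 0 < t \<and> deriv (\<lambda>s. (norm (velocity x s))\<^sup>2) t \<le> 0})"

end

(* Multiplying the equation by t^\<alpha> gives d/dt (t^\<alpha> x'(t)) = - t^\<alpha> grad \<phi> (x(t)). With M the supremum of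
   |x'(s)|/s on (0, \<tau>\<^sub>3] this yields |x(s) - z| <= M s^2/2, hence
     |x'(t)/t + grad \<phi> (z)/(\<alpha>+1)| <= q M,  where q = L \<tau>\<^sub>3^2 / (2(\<alpha>+3)) = 1/(2(\<alpha>+2)),
   so that M <= |grad \<phi> (z)| / ((\<alpha>+1)(1-q)) and |x'(t)| >= 2/(2\<alpha>+3) |grad \<phi> (z)| t on (0, \<tau>\<^sub>3].
   Before the restarting time the speed increases, so the energy identity gives
   d/dt \<phi>(x(t)) <= - (\<alpha>/t) |x'(t)|^2. Integrating this over [0, \<tau>\<^sub>3] and using the gradient
   inequality at z gives the decrease. *)

theory Submission
  imports Defs
begin

section \<open>The gradient, and the differential equation at a single time\<close>

text \<open>In finite dimension the derivative, a linear functional, is the inner product with the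
  vector \<open>adjoint f' 1\<close>. Uniqueness of derivatives makes this vector the only
  candidate, so the description \<open>THE\<close> in \<open>gradient\<close> picks it.\<close>

lemma GDERIV_gradient:
  fixes f :: "'a::euclidean_space \<Rightarrow> real"
  assumes "f differentiable (at u)"
  shows "GDERIV f u :> gradient f u"
proof -
  from assms obtain f' where f': "(f has_derivative f') (at u)"
    unfolding differentiable_def by blast
  then have "linear f'"
    by (rule has_derivative_linear)
  then have "f' = (\<lambda>h. h \<bullet> adjoint f' 1)"
    by (simp add: adjoint_works fun_eq_iff)
  with f' have D: "GDERIV f u :> adjoint f' 1"
    by (simp add: gderiv_def)
  show ?thesis
    unfolding gradient_def
  proof (rule theI)
    show "GDERIV f u :> adjoint f' 1" by (rule D)
  next
    fix E assume "GDERIV f u :> E"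
    then have "(\<lambda>h. h \<bullet> E) = (\<lambda>h. h \<bullet> adjoint f' 1)"
      using D unfolding gderiv_def by (rule has_derivative_unique)
    then have "\<And>h. h \<bullet> E = h \<bullet> adjoint f' 1"
      by (rule fun_cong)
    then show "E = adjoint f' 1"
      by (metis vector_eq_ldot)
  qed
qed

text \<open>A positive time is interior to the half-line, so the one-sided derivative in
  \<open>velocity\<close> is the ordinary one there.\<close>

lemma is_solution_has_velocity:
  assumes "is_solution \<phi> \<alpha> z x" "t > 0"
  shows "(x has_vector_derivative velocity x t) (at t)"
proof -
  have "x differentiable (at t within {0..})"
    using assms by (simp add: is_solution_def differentiable_on_def)
  then have "(x has_vector_derivative velocity x t) (at t within {0..})"
    by (simp add: velocity_def vector_derivative_works)
  moreover have "at t within {0..} = at t"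
    using assms by (intro at_within_interior) (simp add: interior_real_atLeast)
  ultimately show ?thesis by simp
qed

text \<open>The equation solved for \<open>acceleration\<close>, so that later arguments deal only
  with \<open>velocity\<close> and the gradient.\<close>

lemma is_solution_has_acceleration:
  assumes "is_solution \<phi> \<alpha> z x" "t > 0"
  shows "(velocity x has_vector_derivative
          - gradient \<phi> (x t) - (\<alpha> / t) *\<^sub>R velocity x t) (at t)"
proof -
  have "velocity x differentiable (at t)"
    using assms unfolding is_solution_def
    by (auto simp: differentiable_on_eq_differentiable_at)
  then have "(velocity x has_vector_derivative acceleration x t) (at t)"
    by (simp add: acceleration_def vector_derivative_works)
  moreover have "acceleration x t + (\<alpha> / t) *\<^sub>R velocity x t + gradient \<phi> (x t) = 0"
    using assms by (simp add: is_solution_def)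
  then have "acceleration x t = - gradient \<phi> (x t) - (\<alpha> / t) *\<^sub>R velocity x t"
    by (simp add: eq_diff_eq eq_neg_iff_add_eq_0)
  ultimately show ?thesis by simp
qed

lemma is_solution_continuous_on:
  assumes "is_solution \<phi> \<alpha> z x"
  shows "continuous_on {0..} x" "continuous_on {0..} (velocity x)"
  using assms by (auto simp: is_solution_def differentiable_imp_continuous_on)

section \<open>Integral estimates for displacement and velocity near time zero\<close>

lemma continuous_on_powr_nonneg:
  fixes p :: real
  assumes "p > 0"
  shows "continuous_on {0..t} (\<lambda>s. s powr p)"
  using assms by (intro continuous_on_powr' continuous_intros) auto

lemma is_solution_displacement_bound:
  assumes sol: "is_solution \<phi> \<alpha> z x" and "t > 0"
    and M: "\<And>s. 0 < s \<Longrightarrow> s < t \<Longrightarrow> norm (velocity x s) \<le> M * s"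
  shows "norm (x t - z) \<le> M / 2 * t\<^sup>2"
proof -
  have "norm (x t - x 0) \<le> M / 2 * t\<^sup>2 - M / 2 * 0\<^sup>2"
  proof (rule differentiable_bound_general[OF \<open>t > 0\<close>])
    show "continuous_on {0..t} x"
      using is_solution_continuous_on(1)[OF sol] by (rule continuous_on_subset) auto
    show "continuous_on {0..t} (\<lambda>s. M / 2 * s\<^sup>2)"
      by (intro continuous_intros)
    show "(x has_vector_derivative velocity x s) (at s)" if "0 < s" "s < t" for s
      using is_solution_has_velocity[OF sol] that by simp
    show "((\<lambda>s. M / 2 * s\<^sup>2) has_vector_derivative M * s) (at s)" for s
      unfolding has_real_derivative_iff_has_vector_derivative[symmetric]
      by (auto intro!: derivative_eq_intros)
  qed (rule M)
  moreover have "x 0 = z"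
    using sol by (simp add: is_solution_def)
  ultimately show ?thesis by simp
qed

text \<open>A constant gradient \<open>g\<close> would give exactly the velocity
  \<open>- t / (\<alpha> + 1)\<close> times \<open>g\<close>; the lemma measures the departure from
  this model. It serves twice: with \<open>g = 0\<close>, \<open>p = 0\<close> for an a priori
  bound, and with the gradient at \<open>z\<close>, \<open>p = 2\<close> for the sharp
  estimate.\<close>

lemma is_solution_velocity_bound:
  assumes sol: "is_solution \<phi> \<alpha> z x" and "\<alpha> > 0" "p \<ge> 0" "t > 0"
    and K: "\<And>s. 0 < s \<Longrightarrow> s < t \<Longrightarrow> norm (gradient \<phi> (x s) - g) \<le> K * s powr p"
  shows "norm ((1 / t) *\<^sub>R velocity x t + (1 / (\<alpha> + 1)) *\<^sub>R g) \<le> K / (\<alpha> + p + 1) * t powr p"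
proof -
  \<comment> \<open>The weight \<open>s powr \<alpha>\<close> is the integrating factor that cancels
    the damping term, and the second summand is an antiderivative of \<open>s powr \<alpha>\<close>
    times \<open>g\<close>. Hence only the deviation of the gradient from \<open>g\<close> survives
    in the derivative.\<close>
  define w where
    "w s = s powr \<alpha> *\<^sub>R velocity x s + (s powr (\<alpha> + 1) / (\<alpha> + 1)) *\<^sub>R g" for s
  have w': "(w has_vector_derivative s powr \<alpha> *\<^sub>R (g - gradient \<phi> (x s))) (at s)"
    if "s > 0" for s
  proof -
    have "((\<lambda>s. s powr \<alpha> *\<^sub>R velocity x s) has_vector_derivative
        s powr \<alpha> *\<^sub>R (- gradient \<phi> (x s) - (\<alpha> / s) *\<^sub>R velocity x s)
        + (\<alpha> * s powr (\<alpha> - 1)) *\<^sub>R velocity x s) (at s)"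
      using that by (intro has_vector_derivative_scaleR has_real_derivative_powr
          is_solution_has_acceleration[OF sol])
    moreover have "((\<lambda>s. s powr (\<alpha> + 1) / (\<alpha> + 1)) has_real_derivative s powr \<alpha>) (at s)"
      using that \<open>\<alpha> > 0\<close> by (auto intro!: derivative_eq_intros)
    then have "((\<lambda>s. (s powr (\<alpha> + 1) / (\<alpha> + 1)) *\<^sub>R g) has_vector_derivative
        s powr \<alpha> *\<^sub>R 0 + s powr \<alpha> *\<^sub>R g) (at s)"
      using has_vector_derivative_scaleR[OF _ has_vector_derivative_const] by fastforce
    ultimately have "(w has_vector_derivative
        s powr \<alpha> *\<^sub>R (- gradient \<phi> (x s) - (\<alpha> / s) *\<^sub>R velocity x s)
        + (\<alpha> * s powr (\<alpha> - 1)) *\<^sub>R velocity x s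
        + (s powr \<alpha> *\<^sub>R 0 + s powr \<alpha> *\<^sub>R g)) (at s)"
      unfolding w_def[abs_def] by (rule has_vector_derivative_add)
    then show ?thesis
      using that by (simp add: powr_diff algebra_simps)
  qed
  \<comment> \<open>The mean value inequality asks for derivatives only on the open interval, which
    avoids the singularity of the equation at 0. Both \<open>w\<close> and its majorant vanish at 0,
    since \<open>0 powr\<close> anything is 0.\<close>
  have "norm (w t - w 0) \<le> K / (\<alpha> + p + 1) * t powr (\<alpha> + p + 1) - K / (\<alpha> + p + 1) * 0 powr (\<alpha> + p + 1)"
  proof (rule differentiable_bound_general[OF \<open>t > 0\<close>])
    have "continuous_on {0..t} (velocity x)"
      using is_solution_continuous_on(2)[OF sol] by (rule continuous_on_subset) auto
    then show "continuous_on {0..t} w"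
      unfolding w_def[abs_def] using \<open>\<alpha> > 0\<close>
      by (intro continuous_intros continuous_on_powr_nonneg) auto
    show "continuous_on {0..t} (\<lambda>s. K / (\<alpha> + p + 1) * s powr (\<alpha> + p + 1))"
      using \<open>\<alpha> > 0\<close> \<open>p \<ge> 0\<close> by (intro continuous_intros continuous_on_powr_nonneg) auto
    fix s assume s: "0 < s" "s < t"
    show "(w has_vector_derivative s powr \<alpha> *\<^sub>R (g - gradient \<phi> (x s))) (at s)"
      using s by (intro w')
    have "\<alpha> + p + 1 > 0"
      using \<open>\<alpha> > 0\<close> \<open>p \<ge> 0\<close> by simp
    then show "((\<lambda>s. K / (\<alpha> + p + 1) * s powr (\<alpha> + p + 1)) has_vector_derivative
        K * s powr (\<alpha> + p)) (at s)"
      unfolding has_real_derivative_iff_has_vector_derivative[symmetric]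
      using s by (auto intro!: derivative_eq_intros)
    show "norm (s powr \<alpha> *\<^sub>R (g - gradient \<phi> (x s))) \<le> K * s powr (\<alpha> + p)"
      using K[OF s] s by (simp add: powr_add norm_minus_commute mult.left_commute mult_left_mono)
  qed
  moreover have "w 0 = 0"
    using \<open>\<alpha> > 0\<close> by (simp add: w_def)
  moreover have "w t = t powr (\<alpha> + 1) *\<^sub>R ((1 / t) *\<^sub>R velocity x t + (1 / (\<alpha> + 1)) *\<^sub>R g)"
    using \<open>t > 0\<close> by (simp add: w_def powr_add algebra_simps)
  ultimately have "t powr (\<alpha> + 1) * norm ((1 / t) *\<^sub>R velocity x t + (1 / (\<alpha> + 1)) *\<^sub>R g)
      \<le> t powr (\<alpha> + 1) * (K / (\<alpha> + p + 1) * t powr p)"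
    using \<open>t > 0\<close> \<open>\<alpha> > 0\<close> \<open>p \<ge> 0\<close> by (simp add: powr_add mult_ac)
  then show ?thesis
    by (rule mult_left_le_imp_le) (use \<open>t > 0\<close> in simp)
qed

text \<open>A self-improving estimate: a linear speed bound with constant \<open>M\<close> controls
  the gradient along the trajectory, which in turn bounds the speed by \<open>q * M\<close> plus a
  known term. As \<open>q < 1\<close>, the term \<open>q * M\<close> can be absorbed.\<close>

lemma is_solution_speed_lower_bound:
  fixes \<phi> :: "'a::real_inner \<Rightarrow> real"
  assumes sol: "is_solution \<phi> \<alpha> z x" and "\<alpha> > 0" "L > 0"
    and lip: "L-lipschitz_on UNIV (gradient \<phi>)"
    and t: "0 < t" "t \<le> sqrt ((\<alpha> + 3) / ((\<alpha> + 2) * L))"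
  shows "2 / (2 * \<alpha> + 3) * norm (gradient \<phi> z) * t \<le> norm (velocity x t)"
proof -
  define \<tau> where "\<tau> = sqrt ((\<alpha> + 3) / ((\<alpha> + 2) * L))"
  define g where "g = gradient \<phi> z"
  define q where "q = 1 / (2 * (\<alpha> + 2))"
  define M where "M = (SUP s\<in>{0<..\<tau>}. norm (velocity x s) / s)"
  have "t \<le> \<tau>"
    using t by (simp add: \<tau>_def)
  have "\<tau> > 0" "\<tau>\<^sup>2 = (\<alpha> + 3) / ((\<alpha> + 2) * L)"
    using \<open>\<alpha> > 0\<close> \<open>L > 0\<close> by (auto simp: \<tau>_def)
  \<comment> \<open>Absorption is legitimate only if the supremum is finite. This follows from
    boundedness of the gradient on the compact piece of trajectory, through the case
    \<open>g = 0\<close>, \<open>p = 0\<close>.\<close>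
  have bdd: "bdd_above ((\<lambda>s. norm (velocity x s) / s) ` {0<..\<tau>})"
  proof -
    have "continuous_on {0..\<tau>} x"
      using is_solution_continuous_on(1)[OF sol] by (rule continuous_on_subset) auto
    moreover have "continuous_on UNIV (gradient \<phi>)"
      using lip by (rule lipschitz_on_continuous_on)
    ultimately have "continuous_on {0..\<tau>} (\<lambda>s. gradient \<phi> (x s))"
      by (metis continuous_on_compose2 subset_UNIV)
    then have "bounded ((\<lambda>s. gradient \<phi> (x s)) ` {0..\<tau>})"
      by (intro compact_imp_bounded compact_continuous_image) auto
    then obtain K where K: "\<And>s. s \<in> {0..\<tau>} \<Longrightarrow> norm (gradient \<phi> (x s)) \<le> K"
      unfolding bounded_iff by (meson imageI)
    have "norm (velocity x s) / s \<le> K / (\<alpha> + 1)" if s: "s \<in> {0<..\<tau>}" for s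
    proof -
      have "norm ((1 / s) *\<^sub>R velocity x s + (1 / (\<alpha> + 1)) *\<^sub>R 0) \<le> K / (\<alpha> + 0 + 1) * s powr 0"
        using s K by (intro is_solution_velocity_bound[OF sol \<open>\<alpha> > 0\<close>]) auto
      then show ?thesis
        using s by simp
    qed
    then show ?thesis
      by (rule bdd_aboveI2)
  qed
  have M: "norm (velocity x s) / s \<le> M" if "s \<in> {0<..\<tau>}" for s
    unfolding M_def by (rule cSUP_upper[OF that bdd])
  have "M \<ge> 0"
    using M[of \<tau>] \<open>\<tau> > 0\<close> by (simp add: order.trans[rotated])
  have near: "norm ((1 / s) *\<^sub>R velocity x s + (1 / (\<alpha> + 1)) *\<^sub>R g) \<le> q * M"
    if s: "s \<in> {0<..\<tau>}" for s
  proof -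
    \<comment> \<open>The speed bound \<open>M * r'\<close> integrates to a quadratic displacement
      bound, and the Lipschitz property transfers it to gradients; this is the growth condition with
      \<open>p = 2\<close>.\<close>
    have disp: "norm (gradient \<phi> (x r) - g) \<le> L * M / 2 * r powr 2" if r: "0 < r" "r < s" for r
    proof -
      have "norm (velocity x r') \<le> M * r'" if "0 < r'" "r' < r" for r'
        using M[of r'] that r s by (simp add: pos_divide_le_eq)
      then have "norm (x r - z) \<le> M / 2 * r\<^sup>2"
        using is_solution_displacement_bound[OF sol] r by blast
      then have "L * norm (x r - z) \<le> L * (M / 2 * r\<^sup>2)"
        using \<open>L > 0\<close> by simp
      moreover have "norm (gradient \<phi> (x r) - g) \<le> L * norm (x r - z)"
        using lipschitz_onD[OF lip, of "x r" z] by (simp add: dist_norm g_def)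
      ultimately show ?thesis
        using r by (simp add: powr_numeral)
    qed
    have "norm ((1 / s) *\<^sub>R velocity x s + (1 / (\<alpha> + 1)) *\<^sub>R g)
        \<le> L * M / 2 / (\<alpha> + 2 + 1) * s powr 2"
      using s disp by (intro is_solution_velocity_bound[OF sol \<open>\<alpha> > 0\<close>]) auto
    also have "\<dots> = L * M / (2 * (\<alpha> + 3)) * s\<^sup>2"
      using s by (simp add: powr_numeral add.assoc)
    \<comment> \<open>Replacing \<open>s\<close> by the endpoint makes the bound uniform; the value
      of \<open>\<tau>\<close> then turns the coefficient into \<open>q\<close>.\<close>
    also have "\<dots> \<le> L * M / (2 * (\<alpha> + 3)) * \<tau>\<^sup>2"
      using s \<open>L > 0\<close> \<open>M \<ge> 0\<close> \<open>\<alpha> > 0\<close> by (intro mult_left_mono power_mono) auto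
    also have "\<dots> = q * M"
      unfolding \<open>\<tau>\<^sup>2 = _\<close> q_def using \<open>L > 0\<close> \<open>\<alpha> > 0\<close> by (simp add: divide_simps) (simp add: algebra_simps)
    finally show ?thesis .
  qed
  have norm_v: "norm ((1 / s) *\<^sub>R velocity x s) = norm (velocity x s) / s"
    and norm_g: "norm ((1 / (\<alpha> + 1)) *\<^sub>R g) = norm g / (\<alpha> + 1)" if "s \<in> {0<..\<tau>}" for s
    using that \<open>\<alpha> > 0\<close> by auto
  have "M \<le> q * M + norm g / (\<alpha> + 1)"
    unfolding M_def
  proof (rule cSUP_least)
    show "{0<..\<tau>} \<noteq> {}"
      using \<open>\<tau> > 0\<close> by simp
    show "norm (velocity x s) / s \<le> q * (SUP s\<in>{0<..\<tau>}. norm (velocity x s) / s) + norm g / (\<alpha> + 1)"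
      if s: "s \<in> {0<..\<tau>}" for s
      using near[OF s] norm_v[OF s] norm_g[OF s]
        norm_diff_ineq[of "(1 / s) *\<^sub>R velocity x s" "(1 / (\<alpha> + 1)) *\<^sub>R g"]
      unfolding M_def by linarith
  qed
  then have "(1 - q) * M \<le> norm g / (\<alpha> + 1)"
    by (simp add: algebra_simps)
  moreover have "1 - q = (2 * \<alpha> + 3) / (2 * (\<alpha> + 2))"
    using \<open>\<alpha> > 0\<close> by (simp add: q_def field_simps)
  \<comment> \<open>Since \<open>q = 1 / (2 * (\<alpha> + 2))\<close>, the factor
    \<open>1 - q\<close> equals \<open>(2 * \<alpha> + 3) * q\<close>.\<close>
  ultimately have "(2 * \<alpha> + 3) * (q * M) \<le> norm g / (\<alpha> + 1)"
    by (simp add: q_def)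
  then have "q * M \<le> norm g / (\<alpha> + 1) / (2 * \<alpha> + 3)"
    using \<open>\<alpha> > 0\<close> by (simp add: pos_le_divide_eq mult_ac)
  moreover have "norm g / (\<alpha> + 1) - norm g / (\<alpha> + 1) / (2 * \<alpha> + 3) = 2 / (2 * \<alpha> + 3) * norm g"
    using \<open>\<alpha> > 0\<close> by (simp add: divide_simps) (simp add: algebra_simps)
  moreover have in_range: "t \<in> {0<..\<tau>}"
    using t \<open>t \<le> \<tau>\<close> by simp
  \<comment> \<open>The triangle inequality now runs in the opposite direction: the speed quotient
    falls short of \<open>norm g / (\<alpha> + 1)\<close> by at most \<open>q * M\<close>.\<close>
  have "norm g / (\<alpha> + 1) \<le> norm (velocity x t) / t + q * M"
    using near[OF in_range] norm_v[OF in_range] norm_g[OF in_range]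
      norm_diff_ineq[of "(1 / (\<alpha> + 1)) *\<^sub>R g" "(1 / t) *\<^sub>R velocity x t"]
    unfolding add.commute[of "(1 / (\<alpha> + 1)) *\<^sub>R g"] by linarith
  ultimately have "2 / (2 * \<alpha> + 3) * norm g \<le> norm (velocity x t) / t"
    by linarith
  then show ?thesis
    using t by (simp add: pos_le_divide_eq g_def)
qed

section \<open>Decrease of the objective up to the restarting time\<close>

lemma speed_increasing_before_restarting_time:
  assumes "0 < t" "ereal t < restarting_time x"
  shows "deriv (\<lambda>s. (norm (velocity x s))\<^sup>2) t > 0"
proof (rule ccontr)
  assume "\<not> ?thesis"
  then have "restarting_time x \<le> ereal t"
    unfolding restarting_time_def using assms by (intro Inf_lower) auto
  with assms show False by simp
qed

text \<open>\<open>D\<close> is the inner product of velocity and gradient. Pairing the equation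
  with the velocity expresses half the derivative of the squared speed as
  \<open>- D - (\<alpha> / t) * (norm (velocity x t))\<^sup>2\<close>, and this is positive before
  the restarting time.\<close>

lemma is_solution_energy_decrease:
  fixes \<phi> :: "'a::euclidean_space \<Rightarrow> real"
  assumes sol: "is_solution \<phi> \<alpha> z x" and diff: "\<And>u. \<phi> differentiable (at u)"
    and t: "0 < t" "ereal t < restarting_time x"
  obtains D where "((\<lambda>s. \<phi> (x s)) has_real_derivative D) (at t)"
    and "D \<le> - (\<alpha> / t) * (norm (velocity x t))\<^sup>2"
proof
  define v where "v = velocity x t"
  define g where "g = gradient \<phi> (x t)"
  have "(\<phi> has_derivative (\<lambda>h. h \<bullet> g)) (at (x t))"
    using GDERIV_gradient[OF diff] by (simp add: gderiv_def g_def)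
  moreover have "(x has_derivative (\<lambda>h. h *\<^sub>R v)) (at t)"
    using is_solution_has_velocity[OF sol t(1)] by (simp add: has_vector_derivative_def v_def)
  ultimately have "((\<lambda>s. \<phi> (x s)) has_derivative (\<lambda>h. (h *\<^sub>R v) \<bullet> g)) (at t)"
    by (rule has_derivative_compose[rotated])
  then show "((\<lambda>s. \<phi> (x s)) has_real_derivative v \<bullet> g) (at t)"
    by (simp add: has_field_derivative_def mult.commute[of _ "v \<bullet> g"])
  have "(velocity x has_derivative (\<lambda>h. h *\<^sub>R (- g - (\<alpha> / t) *\<^sub>R v))) (at t)"
    using is_solution_has_acceleration[OF sol t(1)]
    by (simp add: has_vector_derivative_def v_def g_def)
  then have "((\<lambda>s. velocity x s \<bullet> velocity x s) has_derivative
      (\<lambda>h. v \<bullet> (h *\<^sub>R (- g - (\<alpha> / t) *\<^sub>R v)) + (h *\<^sub>R (- g - (\<alpha> / t) *\<^sub>R v)) \<bullet> v)) (at t)"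
    unfolding v_def by (intro has_derivative_inner)
  then have "((\<lambda>s. (norm (velocity x s))\<^sup>2) has_real_derivative
      2 * (v \<bullet> (- g - (\<alpha> / t) *\<^sub>R v))) (at t)"
    unfolding has_field_derivative_def power2_norm_eq_inner
    by (rule has_derivative_eq_rhs) (simp add: fun_eq_iff inner_commute)
  then have "2 * (v \<bullet> (- g - (\<alpha> / t) *\<^sub>R v)) > 0"
    using speed_increasing_before_restarting_time[OF t] by (simp add: DERIV_imp_deriv)
  then show "v \<bullet> g \<le> - (\<alpha> / t) * (norm (velocity x t))\<^sup>2"
    by (simp add: inner_diff_right power2_norm_eq_inner flip: v_def)
qed

lemma is_solution_value_decrease:
  fixes \<phi> :: "'a::euclidean_space \<Rightarrow> real"
  assumes sol: "is_solution \<phi> \<alpha> z x" and diff: "\<And>u. \<phi> differentiable (at u)"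
    and pos: "\<alpha> > 0" "L > 0"
    and lip: "L-lipschitz_on UNIV (gradient \<phi>)"
    and t: "sqrt ((\<alpha> + 3) / ((\<alpha> + 2) * L)) \<le> t" "ereal t \<le> restarting_time x"
  shows "\<phi> (x t) \<le> \<phi> z - 2 * \<alpha> * (\<alpha> + 3) / ((\<alpha> + 2) * (2 * \<alpha> + 3)\<^sup>2) / L * (norm (gradient \<phi> z))\<^sup>2"
proof -
  define \<tau> where "\<tau> = sqrt ((\<alpha> + 3) / ((\<alpha> + 2) * L))"
  define c where "c = 2 / (2 * \<alpha> + 3) * norm (gradient \<phi> z)"
  have \<tau>: "\<tau> > 0" "\<tau>\<^sup>2 = (\<alpha> + 3) / ((\<alpha> + 2) * L)" "\<tau> \<le> t"
    using pos t by (auto simp: \<tau>_def)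
  have "c \<ge> 0"
    using pos by (simp add: c_def)
  have cont_\<phi>: "continuous_on UNIV \<phi>"
    using diff by (simp add: continuous_at_imp_continuous_on differentiable_imp_continuous_within)
  have cont: "continuous_on {0..} (\<lambda>s. \<phi> (x s))"
    using cont_\<phi> is_solution_continuous_on(1)[OF sol] by (rule continuous_on_compose2) simp
  \<comment> \<open>The final time may equal the restarting time, where the sign information stops.
    The monotonicity arguments below use derivatives at interior times only and reach the endpoint
    by continuity.\<close>
  have before: "ereal s < restarting_time x" if "s < t" for s
    using that t(2) less_le_trans[of "ereal s" "ereal t"] by simp
  \<comment> \<open>The added quadratic is the integral of \<open>\<alpha> * c\<^sup>2 * s\<close>,
    the decay rate guaranteed by the speed bound \<open>c * s\<close>; the sum is therefore still
    nonincreasing.\<close>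
  have "\<phi> (x \<tau>) + \<alpha> * c\<^sup>2 / 2 * \<tau>\<^sup>2 \<le> \<phi> (x 0) + \<alpha> * c\<^sup>2 / 2 * 0\<^sup>2"
  proof (rule DERIV_nonpos_imp_decreasing_open[where f = "\<lambda>s. \<phi> (x s) + \<alpha> * c\<^sup>2 / 2 * s\<^sup>2"])
    show "0 \<le> \<tau>" using \<tau> by simp
    show "continuous_on {0..\<tau>} (\<lambda>s. \<phi> (x s) + \<alpha> * c\<^sup>2 / 2 * s\<^sup>2)"
      by (intro continuous_intros continuous_on_subset[OF cont]) auto
    fix s assume s: "0 < s" "s < \<tau>"
    obtain D where D: "((\<lambda>s. \<phi> (x s)) has_real_derivative D) (at s)"
      and D_le: "D \<le> - (\<alpha> / s) * (norm (velocity x s))\<^sup>2"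
      using is_solution_energy_decrease[OF sol diff] s \<tau> before by (metis less_le_trans)
    have "c * s \<le> norm (velocity x s)"
      unfolding c_def using s by (intro is_solution_speed_lower_bound[OF sol pos lip]) (auto simp: \<tau>_def)
    then have "(c * s)\<^sup>2 \<le> (norm (velocity x s))\<^sup>2"
      using \<open>c \<ge> 0\<close> s by (intro power_mono) auto
    then have "\<alpha> / s * (c * s)\<^sup>2 \<le> \<alpha> / s * (norm (velocity x s))\<^sup>2"
      using pos s by (intro mult_left_mono) auto
    moreover have "\<alpha> / s * (c * s)\<^sup>2 = \<alpha> * c\<^sup>2 * s"
      using s by (simp add: power2_eq_square)
    ultimately have "D + \<alpha> * c\<^sup>2 * s \<le> 0"
      using D_le by simp
    moreover have "((\<lambda>s. \<phi> (x s) + \<alpha> * c\<^sup>2 / 2 * s\<^sup>2) has_real_derivative D + \<alpha> * c\<^sup>2 * s) (at s)"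
      using D by (auto intro!: derivative_eq_intros)
    ultimately show "\<exists>y. ((\<lambda>s. \<phi> (x s) + \<alpha> * c\<^sup>2 / 2 * s\<^sup>2) has_real_derivative y) (at s) \<and> y \<le> 0"
      by blast
  qed
  \<comment> \<open>After \<open>\<tau>\<close> the lower speed bound is no longer available, but
    the gain is kept because the objective does not increase.\<close>
  moreover have "\<phi> (x t) \<le> \<phi> (x \<tau>)"
  proof (rule DERIV_nonpos_imp_decreasing_open[OF \<open>\<tau> \<le> t\<close>, where f = "\<lambda>s. \<phi> (x s)"])
    show "continuous_on {\<tau>..t} (\<lambda>s. \<phi> (x s))"
      using \<tau> by (intro continuous_on_subset[OF cont]) auto
    fix s assume s: "\<tau> < s" "s < t"
    obtain D where "((\<lambda>s. \<phi> (x s)) has_real_derivative D) (at s)"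
      and "D \<le> - (\<alpha> / s) * (norm (velocity x s))\<^sup>2"
      using is_solution_energy_decrease[OF sol diff] s \<tau> before by (metis less_trans)
    moreover have "\<alpha> / s * (norm (velocity x s))\<^sup>2 \<ge> 0"
      using pos s \<tau> by simp
    ultimately show "\<exists>y. ((\<lambda>s. \<phi> (x s)) has_real_derivative y) (at s) \<and> y \<le> 0"
      by (intro exI[of _ D]) auto
  qed
  moreover have "\<phi> (x 0) = \<phi> z"
    using sol by (simp add: is_solution_def)
  moreover have "\<alpha> * c\<^sup>2 / 2 * \<tau>\<^sup>2
      = 2 * \<alpha> * (\<alpha> + 3) / ((\<alpha> + 2) * (2 * \<alpha> + 3)\<^sup>2) / L * (norm (gradient \<phi> z))\<^sup>2"
    by (simp add: \<tau>(2) c_def power_mult_distrib power_divide mult_ac)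
  ultimately show ?thesis
    by (simp only: zero_power2 mult_zero_right)
qed

section \<open>The contraction factor, from the gradient inequality at the starting point\<close>

theorem mainTheorem3:
  fixes \<phi> :: "real ^ 'n \<Rightarrow> real"
    and \<phi>_star L \<mu> \<alpha> \<tau>\<^sub>3 :: real
    and z :: "real ^ 'n"
    and x :: "real \<Rightarrow> real ^ 'n"
  assumes "convex_on UNIV \<phi>"
    and "twice_continuously_differentiable \<phi>"
    and "\<phi>_star \<in> range \<phi>" and "\<And>u. \<phi>_star \<le> \<phi> u"
    and "L > 0" and "L-lipschitz_on UNIV (gradient \<phi>)"
    and "\<mu> > 0" and "\<And>u. \<mu> * (\<phi> u - \<phi>_star) \<le> 1 / 2 * (norm (gradient \<phi> u))\<^sup>2"
    and "\<alpha> > 0"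
    and "z \<notin> argmin \<phi>"
    and "is_solution \<phi> \<alpha> z x"
    and "\<tau>\<^sub>3 = sqrt ((\<alpha> + 3) / ((\<alpha> + 2) * L))"
  shows "(\<forall>t::real. \<tau>\<^sub>3 \<le> t \<and> ereal t \<le> restarting_time x \<longrightarrow>
            \<phi> (x t) - \<phi>_star \<le>
              (1 - 4 * \<alpha> * (\<alpha> + 3) / ((\<alpha> + 2) * (2 * \<alpha> + 3)\<^sup>2) * (\<mu> / L)) * (\<phi> z - \<phi>_star))
       \<and> (\<alpha> = 3 \<longrightarrow>
            (\<forall>t::real. \<tau>\<^sub>3 \<le> t \<and> ereal t \<le> restarting_time x \<longrightarrow>
              \<phi> (x t) - \<phi>_star \<le> (1 - 8 / 45 * (\<mu> / L)) * (\<phi> z - \<phi>_star)))"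
proof -
  have diff: "\<And>u. \<phi> differentiable (at u)"
    using assms(2) unfolding twice_continuously_differentiable_def differentiable_def by blast
  \<comment> \<open>\<open>C / L\<close> multiplies the squared gradient norm in the decrease; the
    gradient inequality, with its factor 1/2, doubles it to the stated coefficient.\<close>
  define C where "C = 2 * \<alpha> * (\<alpha> + 3) / ((\<alpha> + 2) * (2 * \<alpha> + 3)\<^sup>2)"
  have C: "4 * \<alpha> * (\<alpha> + 3) / ((\<alpha> + 2) * (2 * \<alpha> + 3)\<^sup>2) = 2 * C"
    by (simp add: C_def)
  have main: "\<phi> (x t) - \<phi>_star \<le> (1 - 2 * C * (\<mu> / L)) * (\<phi> z - \<phi>_star)"
    if t: "\<tau>\<^sub>3 \<le> t" "ereal t \<le> restarting_time x" for t
  proof -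
    have "\<phi> (x t) \<le> \<phi> z - C / L * (norm (gradient \<phi> z))\<^sup>2"
      using is_solution_value_decrease[OF assms(11) diff assms(9,5,6)] t assms(12)
      by (simp add: C_def)
    moreover have "C / L \<ge> 0"
      using assms(5,9) by (simp add: C_def)
    then have "C / L * (2 * (\<mu> * (\<phi> z - \<phi>_star))) \<le> C / L * (norm (gradient \<phi> z))\<^sup>2"
      using assms(8)[of z] by (intro mult_left_mono) auto
    ultimately show ?thesis
      by (simp add: algebra_simps diff_divide_distrib)
  qed
  \<comment> \<open>Here \<open>2 * C\<close> is 72/405.\<close>
  moreover have "2 * C = 8 / 45" if "\<alpha> = 3"
    using that by (simp add: C_def)
  ultimately show ?thesis
    unfolding C by (metis (lifting))
qed

end
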